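(* Let $\beta \ge 3$ and $n \ge 1$ be integers. There is a permutation $\sigma \in S_n$ which maximizes the number of occurrences of $\tau_{2,\beta}$ among all permutations in $S_n$ and which consists of a single antilayer followed by a single layer, i.e. $\sigma = [1,2,\dots,x,n,n-1,\dots,x+1]$ for some $x \in \{0,1,\dots,n\}$. Hence the maximum number of occurrences of $\tau_{2,\beta}$ in a permutation in $S_n$ is $$g(\tau_{2,\beta},n) = \max_{x \in \{0,1,\dots,n\}} \binom{x}{2}\binom{n-x}{\beta}.$$
   Context: Permutations are written in one-line notation. For $\sigma \in S_n$ and a pattern $\tau \in S_m$, an occurrence of $\tau$ in $\sigma$ is an $m$-subset $S \subseteq \{1,\dots,n\}$ such that the restriction of $\sigma$ to $S$ is order-isomorphic to $\tau$ (there are none if $m>n$). Let $g(\tau,\sigma)$ be the number of occurrences of $\tau$ in $\sigma$, and let $g(\tau,n) = \max_{\sigma \in S_n} g(\tau,\sigma)$. A layer is a contiguous decreasing subsequence of consecutive integers; an antilayer is a contiguous increasing subsequence of consecutive integers. The pattern $\tau_{2,\beta} \in S_{\beta+2}$ is $[1,2,\beta+2,\beta+1,\dots,3]$, i.e. the layered permutation with layer sizes $(1,1,\beta)$. *)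

theory Defs
  imports "HOL-Combinatorics.Permutations"
begin

text \<open>A permutation of size \<open>n\<close> is a function \<open>\<sigma>\<close> with \<open>\<sigma> permutes {1..n}\<close>; positions and
  values both start at 1, and one-line notation is extended by the identity outside \<open>{1..n}\<close>.\<close>

definition one_line :: "nat list \<Rightarrow> nat \<Rightarrow> nat" where
  "one_line xs i = (if i \<in> {1..length xs} then xs ! (i - 1) else i)"

lemma one_line_permutes:
  assumes "distinct xs" "set xs = {1..length xs}"
  shows "one_line xs permutes {1..length xs}"
proof (rule bij_imp_permutes)
  have "bij_betw (\<lambda>i. xs ! (i - 1)) {1..length xs} (set xs)"
  proof (rule bij_betwI')
    fix i j assume "i \<in> {1..length xs}" "j \<in> {1..length xs}"
    then show "(xs ! (i - 1) = xs ! (j - 1)) = (i = j)"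
      using assms(1) by (auto simp: nth_eq_iff_index_eq)
  next
    fix i assume "i \<in> {1..length xs}"
    then show "xs ! (i - 1) \<in> set xs" by auto
  next
    fix y assume "y \<in> set xs"
    then obtain k where "k < length xs" "xs ! k = y" by (auto simp: in_set_conv_nth)
    then show "\<exists>i\<in>{1..length xs}. y = xs ! (i - 1)" by (intro bexI[of _ "Suc k"]) auto
  qed
  then show "bij_betw (one_line xs) {1..length xs} {1..length xs}"
    unfolding assms(2)
    by (rule bij_betw_cong[THEN iffD1, rotated]) (simp add: one_line_def)
qed (auto simp: one_line_def)

text \<open>Order isomorphism of the restriction \<open>\<sigma>|S\<close> with \<open>\<tau> \<in> S\<^sub>m\<close>: \<open>e\<close> enumerates the positions
  in \<open>S\<close> in increasing order.\<close>

definition occurrences ::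
    "nat \<Rightarrow> (nat \<Rightarrow> nat) \<Rightarrow> nat \<Rightarrow> (nat \<Rightarrow> nat) \<Rightarrow> nat set set" where
  "occurrences m \<tau> n \<sigma> =
     {S. S \<subseteq> {1..n} \<and> card S = m \<and>
         (\<exists>e. strict_mono_on {1..m} e \<and> e ` {1..m} = S \<and>
              (\<forall>i\<in>{1..m}. \<forall>j\<in>{1..m}. \<sigma> (e i) < \<sigma> (e j) \<longleftrightarrow> \<tau> i < \<tau> j))}"

definition num_occurrences ::
    "nat \<Rightarrow> (nat \<Rightarrow> nat) \<Rightarrow> nat \<Rightarrow> (nat \<Rightarrow> nat) \<Rightarrow> nat" where
  "num_occurrences m \<tau> n \<sigma> = card (occurrences m \<tau> n \<sigma>)"

definition max_occurrences :: "nat \<Rightarrow> (nat \<Rightarrow> nat) \<Rightarrow> nat \<Rightarrow> nat" where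
  "max_occurrences m \<tau> n = Max (num_occurrences m \<tau> n ` {\<sigma>. \<sigma> permutes {1..n}})"

text \<open>\<open>[1, 2, \<beta> + 2, \<beta> + 1, \<dots>, 3]\<close>\<close>

definition tau2 :: "nat \<Rightarrow> nat \<Rightarrow> nat" where
  "tau2 \<beta> = one_line ([1, 2] @ rev [3..<\<beta> + 3])"

text \<open>\<open>[1, 2, \<dots>, x, n, n - 1, \<dots>, x + 1]\<close>; for \<open>x = 0\<close> the antilayer is empty, for \<open>x = n\<close>
  the layer is.\<close>

definition antilayer_layer :: "nat \<Rightarrow> nat \<Rightarrow> nat \<Rightarrow> nat" where
  "antilayer_layer n x = one_line ([1..<x + 1] @ rev [x + 1..<n + 1])"

lemma tau2_permutes: "tau2 \<beta> permutes {1..\<beta> + 2}"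
proof -
  let ?xs = "[1, 2] @ rev [3..<\<beta> + 3]"
  have "length ?xs = \<beta> + 2" by simp
  moreover have "set ?xs = {1..\<beta> + 2}" by auto
  moreover have "distinct ?xs" by auto
  ultimately show ?thesis using one_line_permutes[of ?xs] by (simp only: tau2_def)
qed

lemma antilayer_layer_permutes:
  assumes "x \<le> n"
  shows "antilayer_layer n x permutes {1..n}"
proof -
  let ?xs = "[1..<x + 1] @ rev [x + 1..<n + 1]"
  have "length ?xs = n" using assms by (simp del: upt_Suc)
  moreover have "set ?xs = {1..n}" using assms by (auto simp del: upt_Suc)
  moreover have "distinct ?xs" by (auto simp del: upt_Suc)
  ultimately show ?thesis using one_line_permutes[of ?xs] by (simp only: antilayer_layer_def)
qed

end

theory Submission
  imports Defs "HOL-Library.Infinite_Set"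
begin

text \<open>An occurrence of \<open>\<tau>\<^sub>2\<^sub>,\<^sub>\<beta>\<close> in \<open>\<pi>\<close> is a tower in the poset
  \<open>i < j \<and> \<pi> i < \<pi> j\<close>: a pair \<open>p < q\<close> below an antichain of size \<open>\<beta>\<close>. For two incomparable
  elements \<open>u, v\<close>, either turning \<open>v\<close> into a twin of \<open>u\<close> or turning \<open>u\<close> into a twin of \<open>v\<close> does not
  decrease the number of towers (Zykov symmetrization), so the maximum over all posets is attained by a weak
  order, i.e. a sequence of layers. Going up through the layers, everything seen so far may
  be assumed to be a chain of \<open>x\<close> elements below one layer of size \<open>y\<close>. When the next layer, of
  size \<open>z\<close>, is added, either breaking the layer \<open>y\<close> up into a chain or merging \<open>y\<close> and \<open>z\<close> into one
  layer does not decrease the count.\<close>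

section \<open>Binomial inequalities for comparing block sizes\<close>

lemma Suc_mult_choose_Suc: "Suc k * (n choose Suc k) = (n - k) * (n choose k)"
  using times_binomial_minus1_eq[of "Suc k" n] binomial_absorb_comp[of n k] by simp

lemma double_choose_Suc_le:
  assumes "k \<ge> 1"
  shows "2 * (n choose Suc k) \<le> (n - 1) * (n choose k)"
proof -
  have "2 * (n choose Suc k) \<le> Suc k * (n choose Suc k)"
    using assms by (intro mult_right_mono) auto
  also have "\<dots> \<le> (n - 1) * (n choose k)"
    unfolding Suc_mult_choose_Suc using assms by (intro mult_right_mono) auto
  finally show ?thesis .
qed

text \<open>These are four of the terms of Vandermonde's sum; \<open>k \<ge> 2\<close> keeps the
  indices \<open>0, 1, k, Suc k\<close> distinct.\<close>

lemma choose_add_ge: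
  assumes "k \<ge> 2"
  shows "(y choose Suc k) + (z choose Suc k) + z * (y choose k) + y * (z choose k)
           \<le> (y + z) choose Suc k"
proof -
  have "(\<Sum>i\<in>{0, 1, k, Suc k}. (y choose i) * (z choose (Suc k - i)))
      \<le> (\<Sum>i\<le>Suc k. (y choose i) * (z choose (Suc k - i)))"
    by (rule sum_mono2) auto
  then show ?thesis
    unfolding vandermonde using assms by (simp add: Suc_diff_le algebra_simps)
qed

lemma choose_two_add: "(x + y) choose 2 = (x choose 2) + (y choose 2) + x * y"
  by (induction y) (auto simp: numeral_2_eq_2)

lemma double_choose_two: "2 * (n choose 2) = n * (n - 1)"
  using times_binomial_minus1_eq[of 2 n] by simp

text \<open>\<open>F\<close> is the weighted count for a chain of \<open>x\<close> elements below a
  layer of size \<open>y\<close> below a layer of size \<open>z\<close>, each comparable pair having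
  weight \<open>c\<close>. The alternatives are the counts after breaking up the layer
  \<open>y\<close> and after merging \<open>y\<close> with \<open>z\<close>. If both moves lost, the
  two strict inequalities could be combined so that \<open>c\<close> and \<open>B\<close> cancel,
  and what remains is impossible.\<close>

lemma three_blocks_le_two_blocks:
  fixes x y z c k :: nat
  assumes k: "k \<ge> 2"
  defines "F \<equiv> (x choose 2) * (y choose Suc k) + ((x choose 2) + x * y) * ((z choose Suc k) + c)
                 + c * ((x + y) * z)"
  shows "F \<le> ((x + y) choose 2) * (z choose Suc k) + c * (((x + y) choose 2) + (x + y) * z) \<or>
         F \<le> (x choose 2) * ((y + z) choose Suc k) + c * ((x choose 2) + x * (y + z))"
proof (rule ccontr)
  assume neg: "\<not> ?thesis"
  define X Y B D P Q where "X = x choose 2" "Y = y choose 2" "B = y choose Suc k"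
    "D = z choose Suc k" "P = y choose k" "Q = z choose k"
  note defs = this
  have X2: "2 * X = x * (x - 1)" and Y2: "2 * Y = y * (y - 1)"
    by (simp_all add: defs double_choose_two)
  have B2: "2 * B \<le> (y - 1) * P" and D2: "2 * D \<le> z * Q"
    using double_choose_Suc_le[of k y] double_choose_Suc_le[of k z] k
    by (auto simp: defs intro: order.trans[OF _ mult_right_mono])
  \<comment> \<open>Breaking up the layer \<open>y\<close> gains \<open>Y * (D + c)\<close> and
    loses \<open>X * B\<close>.\<close>
  have flat: "Y * (D + c) < X * B"
    using neg unfolding F_def choose_two_add defs[symmetric] by (simp add: algebra_simps)
  have "X * (B + D + z * P + y * Q) \<le> X * ((y + z) choose Suc k)"
    using choose_add_ge[OF k, of y z] by (intro mult_left_mono) (auto simp: defs)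
  moreover have "X * ((y + z) choose Suc k) < X * B + (X + x * y) * D + c * y * z"
    using neg unfolding F_def choose_two_add defs[symmetric] by (simp add: algebra_simps)
  \<comment> \<open>Merging gains at least the left-hand side and loses exactly the right-hand
    side.\<close>
  ultimately have merge: "X * (z * P + y * Q) < x * y * D + c * y * z"
    by (simp add: algebra_simps)
  have y: "y \<ge> 2"
  proof (rule ccontr)
    assume "\<not> y \<ge> 2"
    then have "B = 0" using k by (simp add: defs binomial_eq_0)
    with flat show False by simp
  qed
  define w where "w = y * (y - 1)"
  have w_eq: "w = 2 * Y" by (simp only: w_def Y2)
  have w: "w > 0" using y by (simp add: w_def)
  \<comment> \<open>The factor \<open>y - 1\<close> turns \<open>P\<close> into a bound for
    \<open>2 * B\<close> by \<open>B2\<close>; then \<open>flat\<close>, multiplied by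
    \<open>2 * z\<close>, removes \<open>B\<close> together with \<open>c\<close>.\<close>
  have "(y - 1) * (X * (z * P + y * Q)) < (y - 1) * (x * y * D + c * y * z)"
    using merge y by (intro mult_strict_left_mono) auto
  then have "X * z * ((y - 1) * P) + w * (X * Q) < w * (x * D) + z * (w * c)"
    by (simp add: w_def algebra_simps)
  moreover have "X * z * (2 * B) \<le> X * z * ((y - 1) * P)"
    using B2 by (intro mult_left_mono) auto
  moreover have "z * (w * (D + c)) \<le> z * (2 * (X * B))"
    using flat by (intro mult_left_mono) (auto simp: w_eq)
  ultimately have "w * (X * Q + z * D) < w * (x * D)"
    by (simp add: algebra_simps)
  then have key: "X * Q + z * D < x * D" using w by simp
  then have "z * D < x * D" by linarith
  then have xz: "z < x" by simp
  \<comment> \<open>By \<open>D2\<close> and \<open>z \<le> x - 1\<close>, the right-hand side is at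
    most \<open>x * (x - 1) * Q\<close>, which is the left-hand side again.\<close>
  have "2 * (X * Q) < 2 * ((x - z) * D)"
    using key by (simp add: diff_mult_distrib)
  also have "\<dots> \<le> (x - z) * (z * Q)"
    using mult_left_mono[OF D2, of "x - z"] by (simp add: algebra_simps)
  also have "\<dots> \<le> (x * (x - 1)) * Q"
    using xz by (auto simp: mult.assoc[symmetric] intro!: mult_mono)
  also have "\<dots> = 2 * (X * Q)" unfolding X2[symmetric] by simp
  finally show False by simp
qed

section \<open>Towers in posets and Zykov symmetrization\<close>

definition tower :: "nat \<Rightarrow> ('a \<Rightarrow> 'a \<Rightarrow> bool) \<Rightarrow> 'a \<Rightarrow> 'a \<Rightarrow> 'a set \<Rightarrow> bool" where
  "tower b r p q K \<longleftrightarrow> card K = b \<and> r p q \<and> (\<forall>k\<in>K. r p k \<and> r q k) \<and> (\<forall>k\<in>K. \<forall>l\<in>K. \<not> r k l)"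

text \<open>Towers are counted as underlying sets because occurrences are sets of positions.\<close>

definition towers :: "nat \<Rightarrow> ('a \<Rightarrow> 'a \<Rightarrow> bool) \<Rightarrow> 'a set \<Rightarrow> 'a set set" where
  "towers b r V = {S. S \<subseteq> V \<and> (\<exists>p q K. S = insert p (insert q K) \<and> tower b r p q K)}"

definition twins :: "('a \<Rightarrow> 'a \<Rightarrow> bool) \<Rightarrow> 'a set \<Rightarrow> 'a \<Rightarrow> 'a \<Rightarrow> bool" where
  "twins r V x y \<longleftrightarrow> (\<forall>z\<in>V. r x z = r y z \<and> r z x = r z y)"

text \<open>The number of these pairs breaks ties between relations with equally many
  towers.\<close>

definition twin_pairs :: "('a \<Rightarrow> 'a \<Rightarrow> bool) \<Rightarrow> 'a set \<Rightarrow> ('a \<times> 'a) set" where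
  "twin_pairs r V = {(x, y) \<in> V \<times> V. twins r V x y}"

definition weak_order_on :: "'a set \<Rightarrow> ('a \<Rightarrow> 'a \<Rightarrow> bool) \<Rightarrow> bool" where
  "weak_order_on V r \<longleftrightarrow> irreflp r \<and> transp r \<and>
     (\<forall>x\<in>V. \<forall>y\<in>V. \<not> r x y \<longrightarrow> \<not> r y x \<longrightarrow> twins r V x y)"

text \<open>This is the pullback of \<open>r\<close> along the map sending \<open>v\<close> to
  \<open>u\<close>, so irreflexivity and transitivity are inherited and \<open>v\<close> becomes a
  twin of \<open>u\<close>.\<close>

definition clone :: "'a \<Rightarrow> 'a \<Rightarrow> ('a \<Rightarrow> 'a \<Rightarrow> bool) \<Rightarrow> 'a \<Rightarrow> 'a \<Rightarrow> bool" where
  "clone u v r x y = r ((id(v := u)) x) ((id(v := u)) y)"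

lemma finite_towers: "finite V \<Longrightarrow> finite (towers b r V)"
  by (rule finite_subset[of _ "Pow V"]) (auto simp: towers_def)

lemma finite_twin_pairs: "finite V \<Longrightarrow> finite (twin_pairs r V)"
  by (rule finite_subset[of _ "V \<times> V"]) (auto simp: twin_pairs_def)

lemma irreflp_clone: "irreflp r \<Longrightarrow> irreflp (clone u v r)"
  by (auto simp: irreflp_def clone_def)

lemma transp_clone: "transp r \<Longrightarrow> transp (clone u v r)"
  by (auto simp: transp_def clone_def)

lemma towers_transfer:
  assumes S: "S \<in> towers b r V" and "g ` S \<subseteq> V" and inj: "inj_on g S"
    and eq: "\<And>x y. x \<in> S \<Longrightarrow> y \<in> S \<Longrightarrow> r' (g x) (g y) = r x y"
  shows "g ` S \<in> towers b r' V"
proof -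
  obtain p q K where S_eq: "S = insert p (insert q K)" and K: "tower b r p q K"
    using S by (auto simp: towers_def)
  have "inj_on g K" using inj S_eq by (auto simp: inj_on_def)
  then have "tower b r' (g p) (g q) (g ` K)"
    using K eq unfolding tower_def S_eq by (auto simp: card_image)
  moreover have "g ` S = insert (g p) (insert (g q) (g ` K))" using S_eq by auto
  ultimately show ?thesis using assms(2) by (auto simp: towers_def)
qed

text \<open>Both \<open>p\<close> and \<open>q\<close> are comparable to every other element of the
  tower, so \<open>u\<close> and \<open>v\<close> lie in the antichain \<open>K\<close>. Hence
  cloning does not disturb a tower containing both.\<close>

lemma incomparable_in_tower:
  assumes S: "S \<in> towers b r V" and po: "irreflp r" "transp r"
    and uv: "u \<in> S" "v \<in> S" "u \<noteq> v" "\<not> r u v" "\<not> r v u" and z: "z \<in> S"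
  shows "r u z = r v z" "r z u = r z v"
proof -
  obtain p q K where S_eq: "S = insert p (insert q K)" and K: "tower b r p q K"
    using S by (auto simp: towers_def)
  have asym: "\<not> r y x" if "r x y" for x y
    using po that by (meson irreflpD transpD)
  have "u \<in> K" "v \<in> K" using uv S_eq K by (auto simp: tower_def)
  then show "r u z = r v z" "r z u = r z v"
    using K z asym unfolding S_eq tower_def by auto
qed

text \<open>Only towers containing \<open>v\<close> but not \<open>u\<close> can be lost. Each tower
  containing \<open>u\<close> but not \<open>v\<close> survives and yields a second one in which
  \<open>v\<close> replaces \<open>u\<close>.\<close>

lemma card_towers_clone:
  assumes fin: "finite V" and po: "irreflp r" "transp r"
    and uv: "u \<in> V" "v \<in> V" "u \<noteq> v" "\<not> r u v" "\<not> r v u"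
  shows "card (towers b r V) + card {S \<in> towers b r V. u \<in> S \<and> v \<notin> S}
         \<le> card (towers b (clone u v r) V) + card {S \<in> towers b r V. v \<in> S \<and> u \<notin> S}"
proof -
  let ?T = "towers b r V" and ?T' = "towers b (clone u v r) V"
  let ?U = "{S \<in> ?T. u \<in> S \<and> v \<notin> S}" and ?W = "{S \<in> ?T. v \<in> S \<and> u \<notin> S}"
  let ?g = "transpose u v"
  have finT: "finite ?T" "finite ?T'" using fin by (auto simp: finite_towers)
  have sub: "S \<subseteq> V" if "S \<in> ?T" for S using that by (auto simp: towers_def)
  have rest: "S \<in> ?T'" if S: "S \<in> ?T" "S \<notin> ?W" for S
  proof -
    have "clone u v r x y = r x y" if "x \<in> S" "y \<in> S" for x y
    proof (cases "v \<in> S")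
      case True
      then have "u \<in> S" using S by auto
      note inc = incomparable_in_tower[OF S(1) po \<open>u \<in> S\<close> True uv(3-5)]
      show ?thesis using inc[of x] inc[of y] inc[OF True] inc[OF \<open>u \<in> S\<close>] that
        by (auto simp: clone_def)
    next
      case False
      then show ?thesis using that by (auto simp: clone_def)
    qed
    then show ?thesis using towers_transfer[of S b r V id "clone u v r"] S sub[OF S(1)] by simp
  qed
  have swap: "?g ` S \<in> ?T'" if S: "S \<in> ?U" for S
  proof (rule towers_transfer)
    show "S \<in> towers b r V" using S by simp
    show "?g ` S \<subseteq> V" using S sub[of S] uv by (auto simp: transpose_def)
    show "clone u v r (?g x) (?g y) = r x y" if "x \<in> S" "y \<in> S" for x y
      using that S uv(3) by (auto simp: clone_def transpose_def)
  qed (rule inj_on_subset[OF inj_transpose subset_UNIV])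
  have "card ((?T - ?W) \<union> (`) ?g ` ?U) \<le> card ?T'"
    using rest swap finT by (intro card_mono) auto
  \<comment> \<open>A swapped tower contains \<open>v\<close> but not \<open>u\<close>, which no set
    in \<open>?T - ?W\<close> does.\<close>
  moreover have "(?T - ?W) \<inter> (`) ?g ` ?U = {}"
    using uv(3) by (auto simp: transpose_def image_iff)
  moreover have "card ((`) ?g ` ?U) = card ?U"
    by (intro card_image inj_onI) (auto simp: inj_image_eq_iff)
  moreover have "card (?T - ?W) + card ?W = card ?T"
    using finT card_mono[of ?T ?W] by (subst card_Diff_subset) auto
  ultimately show ?thesis using finT by (subst (asm) card_Un_disjoint) auto
qed

text \<open>Twin pairs avoiding \<open>v\<close> persist. Those involving \<open>v\<close> number
  \<open>2 * card ?W - 1\<close> before cloning and at least \<open>2 * card ?U + 1\<close> after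
  it, as \<open>v\<close> joins the class of \<open>u\<close>.\<close>

lemma card_twin_pairs_clone:
  assumes fin: "finite V" and uv: "u \<in> V" "v \<in> V" "u \<noteq> v" "\<not> twins r V u v"
    and le: "card {y \<in> V. twins r V v y} \<le> card {y \<in> V. twins r V u y}"
  shows "card (twin_pairs r V) < card (twin_pairs (clone u v r) V)"
proof -
  let ?P = "twin_pairs r V" and ?P' = "twin_pairs (clone u v r) V"
  let ?U = "{y \<in> V. twins r V u y}" and ?W = "{y \<in> V. twins r V v y}"
  let ?R = "{(x, y) \<in> ?P. x \<noteq> v \<and> y \<noteq> v}"
  have finP: "finite ?P" "finite ?P'" "finite ?R"
    using fin finite_twin_pairs by (auto intro: finite_subset[OF _ finite_twin_pairs[OF fin, of r]])
  have "v \<notin> ?U" using uv by simp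
  have eqP: "?P = ?R \<union> ({v} \<times> ?W \<union> (?W - {v}) \<times> {v})"
    using uv by (auto simp: twin_pairs_def twins_def)
  have "card ?P \<le> card ?R + (card ({v} \<times> ?W) + card ((?W - {v}) \<times> {v}))"
    by (subst eqP) (intro order.trans[OF card_Un_le] add_left_mono card_Un_le)
  also have "\<dots> < card ?R + (2 * card ?U + 1)"
  proof -
    have "v \<in> ?W" using uv by (auto simp: twins_def)
    then have "card (?W - {v}) < card ?W" using fin by (intro psubset_card_mono) auto
    then show ?thesis using le by (simp add: card_cartesian_product)
  qed
  also have "\<dots> = card (?R \<union> (({v} \<times> ?U \<union> ?U \<times> {v}) \<union> {(v, v)}))"
    using finP fin \<open>v \<notin> ?U\<close>
    by (subst card_Un_disjoint | force simp: card_cartesian_product)+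
  also have "\<dots> \<le> card ?P'"
    using finP(2)
  proof (rule card_mono)
    show "?R \<union> (({v} \<times> ?U \<union> ?U \<times> {v}) \<union> {(v, v)}) \<subseteq> ?P'"
      using uv by (auto simp: twin_pairs_def twins_def clone_def)
  qed
  finally show ?thesis .
qed

text \<open>A strict order maximizing first the number of towers and then the number of twin pairs
  must be weak: otherwise cloning between two incomparable elements that are not twins would improve
  it.\<close>

lemma ex_weak_order_towers_ge:
  assumes fin: "finite V" and po: "irreflp r" "transp r"
  shows "\<exists>r'. weak_order_on V r' \<and> card (towers b r V) \<le> card (towers b r' V)"
proof -
  \<comment> \<open>\<open>M\<close> exceeds every twin-pair count, so \<open>\<Phi>\<close> encodes
    the lexicographic order.\<close>
  define M where "M = card (V \<times> V) + 1"
  define \<Phi> where "\<Phi> s = card (towers b s V) * M + card (twin_pairs s V)" for s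
  have "card (twin_pairs s V) \<le> card (V \<times> V)" for s
    using fin by (intro card_mono) (auto simp: twin_pairs_def)
  then have twin_less: "card (twin_pairs s V) < M" for s
    by (simp add: M_def less_Suc_eq_le)
  have \<Phi>_mono: "\<Phi> s < \<Phi> t" if "card (towers b s V) < card (towers b t V)" for s t
  proof -
    have "\<Phi> s < Suc (card (towers b s V)) * M" using twin_less[of s] by (simp add: \<Phi>_def)
    also have "\<dots> \<le> card (towers b t V) * M" using that by (intro mult_right_mono) auto
    finally show ?thesis by (simp add: \<Phi>_def)
  qed
  \<comment> \<open>A uniform bound guarantees a maximizer even though the type may carry infinitely
    many relations.\<close>
  have "\<Phi> s < Suc (card (Pow V) * M + M)" for s
  proof -
    have "card (towers b s V) \<le> card (Pow V)"
      using fin by (intro card_mono) (auto simp: towers_def)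
    then have "card (towers b s V) * M \<le> card (Pow V) * M" by (rule mult_right_mono) simp
    then show ?thesis using twin_less[of s] unfolding \<Phi>_def by linarith
  qed
  then obtain s where s: "irreflp s" "transp s"
    and max: "\<And>t. irreflp t \<Longrightarrow> transp t \<Longrightarrow> \<Phi> t \<le> \<Phi> s"
    using ex_has_greatest_nat[of "\<lambda>s. irreflp s \<and> transp s" r \<Phi> "Suc (card (Pow V) * M + M)"] po
    by blast
  let ?U = "\<lambda>u v. card {S \<in> towers b s V. u \<in> S \<and> v \<notin> S}"
  let ?C = "\<lambda>u. card {y \<in> V. twins s V u y}"
  have no_gain: False
    if uv: "u \<in> V" "v \<in> V" "\<not> s u v" "\<not> s v u" "\<not> twins s V u v"
      and gain: "?U v u < ?U u v \<or> ?U u v = ?U v u \<and> ?C v \<le> ?C u" for u v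
  proof -
    have "u \<noteq> v" using uv(5) by (auto simp: twins_def)
    note towers = card_towers_clone[OF fin s uv(1,2) this uv(3,4), of b]
    have "\<Phi> s < \<Phi> (clone u v s)"
    proof (cases "card (towers b s V) < card (towers b (clone u v s) V)")
      case True
      then show ?thesis by (rule \<Phi>_mono)
    next
      case False
      then have "card (towers b (clone u v s) V) = card (towers b s V)" "?C v \<le> ?C u"
        using towers gain by auto
      then show ?thesis
        using card_twin_pairs_clone[OF fin uv(1,2) \<open>u \<noteq> v\<close> uv(5)] by (simp add: \<Phi>_def)
    qed
    then show False using max[OF irreflp_clone[OF s(1)] transp_clone[OF s(2)], of u v] by simp
  qed
  have "twins s V u v" if "u \<in> V" "v \<in> V" "\<not> s u v" "\<not> s v u" for u v
  proof (rule ccontr)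
    assume nt: "\<not> twins s V u v"
    then have "\<not> twins s V v u" by (auto simp: twins_def)
    \<comment> \<open>One direction always qualifies: clone the element in more towers without the
      other or, in a tie, the one with the larger twin class.\<close>
    from no_gain[OF that nt] no_gain[OF that(2,1,4,3) this] show False by linarith
  qed
  then have "weak_order_on V s" using s by (simp add: weak_order_on_def)
  moreover have "card (towers b r V) \<le> card (towers b s V)"
    using \<Phi>_mono[of s r] max[OF po] by (meson not_le)
  ultimately show ?thesis by blast
qed

section \<open>Counting towers in weak orders layer by layer\<close>

definition tower_triples :: "nat \<Rightarrow> ('a \<Rightarrow> 'a \<Rightarrow> bool) \<Rightarrow> 'a set \<Rightarrow> ('a \<times> 'a \<times> 'a set) set" where
  "tower_triples b r V = {(p, q, K). p \<in> V \<and> q \<in> V \<and> K \<subseteq> V \<and> tower b r p q K}"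

definition less_pairs :: "('a \<Rightarrow> 'a \<Rightarrow> bool) \<Rightarrow> 'a set \<Rightarrow> ('a \<times> 'a) set" where
  "less_pairs r V = {(p, q) \<in> V \<times> V. r p q}"

lemma finite_tower_triples: "finite V \<Longrightarrow> finite (tower_triples b r V)"
  by (rule finite_subset[of _ "V \<times> V \<times> Pow V"]) (auto simp: tower_triples_def)

lemma finite_less_pairs: "finite V \<Longrightarrow> finite (less_pairs r V)"
  by (rule finite_subset[of _ "V \<times> V"]) (auto simp: less_pairs_def)

text \<open>Every tower comes from a triple. Triples are easier to split by layers, and the upper
  bound needs only this direction.\<close>

lemma card_towers_le_triples:
  assumes "finite V"
  shows "card (towers b r V) \<le> card (tower_triples b r V)"
proof (rule surj_card_le[OF finite_tower_triples[OF assms]])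
  show "towers b r V \<subseteq> (\<lambda>(p, q, K). insert p (insert q K)) ` tower_triples b r V"
  proof
    fix S assume "S \<in> towers b r V"
    then obtain p q K where "S \<subseteq> V" "S = insert p (insert q K)" "tower b r p q K"
      by (auto simp: towers_def)
    then show "S \<in> (\<lambda>(p, q, K). insert p (insert q K)) ` tower_triples b r V"
      by (intro image_eqI[of _ _ "(p, q, K)"]) (auto simp: tower_triples_def)
  qed
qed

text \<open>Choose a maximal element \<open>m\<close>. Whatever is not below \<open>m\<close> is
  incomparable to it, hence a twin of it; these elements form \<open>Z\<close>, and those below
  \<open>m\<close> form \<open>W\<close>.\<close>

lemma weak_order_top_layer:
  assumes "finite V" "V \<noteq> {}" and r: "weak_order_on V r"
  obtains W Z where "V = W \<union> Z" "W \<inter> Z = {}" "Z \<noteq> {}" "weak_order_on W r"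
    "\<And>z y. z \<in> Z \<Longrightarrow> y \<in> V \<Longrightarrow> \<not> r z y" "\<And>w z. w \<in> W \<Longrightarrow> z \<in> Z \<Longrightarrow> r w z"
proof -
  have irr: "\<not> r x x" and tr: "r x y \<Longrightarrow> r y z \<Longrightarrow> r x z" for x y z
    using r unfolding weak_order_on_def by (auto dest: irreflpD transpD)
  have "\<exists>m\<in>V. \<forall>x\<in>V. x \<noteq> m \<longrightarrow> \<not> r m x"
    using irr tr by (intro Finite_Set.bex_max_element assms(1,2) asymp_onI transp_onI) blast+
  then obtain m where m: "m \<in> V" "\<And>x. x \<in> V \<Longrightarrow> \<not> r m x" using irr by metis
  have like_m: "r z y = r m y" "r y z = r y m" if "z \<in> V" "\<not> r z m" "y \<in> V" for z y
    using r m that unfolding weak_order_on_def twins_def by blast+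
  show ?thesis
  proof (rule that[of "{x \<in> V. r x m}" "{x \<in> V. \<not> r x m}"])
    show "weak_order_on {x \<in> V. r x m} r"
      using r unfolding weak_order_on_def twins_def by blast
    show "\<not> r z y" if "z \<in> {x \<in> V. \<not> r x m}" "y \<in> V" for z y
      using that like_m(1) m(2) by blast
    show "r w z" if "w \<in> {x \<in> V. r x m}" "z \<in> {x \<in> V. \<not> r x m}" for w z
      using that like_m(2) by blast
  qed (use m in auto)
qed

text \<open>The weight \<open>c\<close> on comparable pairs accounts for the layers above \<open>V\<close>: removing a top layer of
  size \<open>z\<close> raises it by \<open>z choose Suc k\<close>.\<close>

lemma weak_order_towers_bound:
  assumes k: "k \<ge> 2" and "finite V" and "weak_order_on V r"
  shows "\<exists>x y. x + y = card V \<and>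
           card (tower_triples (Suc k) r V) + c * card (less_pairs r V)
           \<le> (x choose 2) * (y choose Suc k) + c * ((x choose 2) + x * y)"
  using assms(2,3)
proof (induction V arbitrary: c rule: finite_psubset_induct)
  case (psubset V)
  show ?case
  proof (cases "V = {}")
    case True
    have "tower_triples (Suc k) r {} = {}" "less_pairs r {} = {}"
      by (auto simp: tower_triples_def less_pairs_def)
    with True show ?thesis by simp
  next
    case False
    from weak_order_top_layer[OF psubset.hyps False psubset.prems]
    obtain W Z where WZ: "V = W \<union> Z" "W \<inter> Z = {}" "Z \<noteq> {}" and W: "weak_order_on W r"
      and top: "\<And>z y. z \<in> Z \<Longrightarrow> y \<in> V \<Longrightarrow> \<not> r z y" and below: "\<And>w z. w \<in> W \<Longrightarrow> z \<in> Z \<Longrightarrow> r w z"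
      by metis
    have fin: "finite W" "finite Z" using psubset.hyps WZ(1) by auto
    define z c' where "z = card Z" and "c' = c + (z choose Suc k)"
    have "W \<subset> V" using WZ by auto
    from psubset.IH[OF this W, of c'] obtain x y where xy: "x + y = card W"
      and IH: "card (tower_triples (Suc k) r W) + c' * card (less_pairs r W)
               \<le> (x choose 2) * (y choose Suc k) + c' * ((x choose 2) + x * y)"
      by blast
    let ?K = "{K. K \<subseteq> Z \<and> card K = Suc k}"
    \<comment> \<open>Since \<open>p\<close> and \<open>q\<close> have elements above them, they lie
      in \<open>W\<close>; since all of \<open>W\<close> is below all of \<open>Z\<close>, the
      antichain \<open>K\<close> lies entirely in one of the two.\<close>
    have "tower_triples (Suc k) r V
          \<subseteq> tower_triples (Suc k) r W \<union> (\<lambda>((p, q), K). (p, q, K)) ` (less_pairs r W \<times> ?K)"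
    proof (clarify, goal_cases)
      case (1 p q K)
      then have V: "p \<in> V" "q \<in> V" "K \<subseteq> V" and t: "tower (Suc k) r p q K"
        by (auto simp: tower_triples_def)
      have "K \<noteq> {}" using t by (auto simp: tower_def)
      then have pq: "p \<in> W" "q \<in> W" "r p q" using t V top WZ(1) by (auto simp: tower_def)
      have "\<not> r l k" if "k \<in> K" "l \<in> K" for k l using t that by (simp add: tower_def)
      then have "K \<subseteq> W \<or> K \<subseteq> Z" using V(3) below WZ(1) by blast
      moreover have "(p, q, K) \<in> (\<lambda>((p, q), K). (p, q, K)) ` (less_pairs r W \<times> ?K)" if "K \<subseteq> Z"
        using that pq t by (auto simp: less_pairs_def tower_def image_iff)
      ultimately show ?case using 1 pq t by (auto simp: tower_triples_def)
    qed
    then have "card (tower_triples (Suc k) r V)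
        \<le> card (tower_triples (Suc k) r W \<union> (\<lambda>((p, q), K). (p, q, K)) ` (less_pairs r W \<times> ?K))"
      using fin by (intro card_mono) (auto simp: finite_tower_triples finite_less_pairs)
    also have "\<dots> \<le> card (tower_triples (Suc k) r W) + card (less_pairs r W \<times> ?K)"
      using fin by (intro order.trans[OF card_Un_le] add_left_mono card_image_le)
        (auto simp: finite_less_pairs)
    also have "card (less_pairs r W \<times> ?K) = (z choose Suc k) * card (less_pairs r W)"
      using fin(2) by (simp add: card_cartesian_product n_subsets z_def)
    finally have triples: "card (tower_triples (Suc k) r V)
        \<le> card (tower_triples (Suc k) r W) + (z choose Suc k) * card (less_pairs r W)" .
    have "less_pairs r V \<subseteq> less_pairs r W \<union> W \<times> Z"
      using top WZ(1) by (auto simp: less_pairs_def)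
    then have "card (less_pairs r V) \<le> card (less_pairs r W \<union> W \<times> Z)"
      using fin by (intro card_mono) (auto simp: finite_less_pairs)
    also have "\<dots> \<le> card (less_pairs r W) + (x + y) * z"
      by (intro order.trans[OF card_Un_le]) (simp add: card_cartesian_product xy z_def)
    finally have "c * card (less_pairs r V) \<le> c * (card (less_pairs r W) + (x + y) * z)"
      by (rule mult_left_mono) simp
    \<comment> \<open>The induction hypothesis has replaced \<open>W\<close> by a chain of
      \<open>x\<close> below a layer of \<open>y\<close>; adding \<open>Z\<close> gives the
      three-block count.\<close>
    with triples IH have "card (tower_triples (Suc k) r V) + c * card (less_pairs r V)
        \<le> (x choose 2) * (y choose Suc k) + ((x choose 2) + x * y) * ((z choose Suc k) + c)
           + c * ((x + y) * z)"
      by (simp add: c'_def algebra_simps)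
    moreover have "(x + y) + z = card V" "x + (y + z) = card V"
      using fin WZ xy by (auto simp: card_Un_disjoint z_def)
    ultimately show ?thesis
      using three_blocks_le_two_blocks[OF k, of x y z c] by (meson order.trans)
  qed
qed

section \<open>Occurrences in permutations as towers\<close>

lemma tau2_simps:
  "tau2 b (Suc 0) = 1"
  "tau2 b 2 = 2"
  "i \<in> {3..b + 2} \<Longrightarrow> tau2 b i = b + 5 - i"
  by (auto simp: tau2_def one_line_def nth_append rev_nth nth_Cons' simp del: upt_Suc)

lemma antilayer_layer_simps:
  "x \<le> n \<Longrightarrow> i \<in> {1..x} \<Longrightarrow> antilayer_layer n x i = i"
  "x \<le> n \<Longrightarrow> i \<in> {x + 1..n} \<Longrightarrow> antilayer_layer n x i = n + x + 1 - i"
  by (auto simp: antilayer_layer_def one_line_def nth_append rev_nth simp del: upt_Suc)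

text \<open>The first two positions of an occurrence serve as \<open>p\<close> and \<open>q\<close>;
  the other \<open>b\<close> carry decreasing values and so form an antichain.\<close>

lemma occurrences_subset_towers:
  "occurrences (b + 2) (tau2 b) n \<pi> \<subseteq> towers b (\<lambda>i j. i < j \<and> \<pi> i < \<pi> j) {1..n}"
proof
  fix S assume "S \<in> occurrences (b + 2) (tau2 b) n \<pi>"
  then obtain e where S: "S \<subseteq> {1..n}" "e ` {1..b + 2} = S" and mono: "strict_mono_on {1..b + 2} e"
    and iso: "\<And>i j. i \<in> {1..b + 2} \<Longrightarrow> j \<in> {1..b + 2} \<Longrightarrow> \<pi> (e i) < \<pi> (e j) \<longleftrightarrow> tau2 b i < tau2 b j"
    unfolding occurrences_def by blast
  have e_less: "e i < e j \<longleftrightarrow> i < j" if "i \<in> {1..b + 2}" "j \<in> {1..b + 2}" for i j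
    using strict_mono_on_less[OF mono that] .
  have "{1..b + 2} = insert 1 (insert 2 {3..b + 2})" by auto
  then have "S = insert (e 1) (insert (e 2) (e ` {3..b + 2}))" using S(2) by auto
  moreover have "tower b (\<lambda>i j. i < j \<and> \<pi> i < \<pi> j) (e 1) (e 2) (e ` {3..b + 2})"
  proof -
    have "inj_on e {3..b + 2}"
      using strict_mono_on_imp_inj_on[OF mono] by (rule inj_on_subset) auto
    then have "card (e ` {3..b + 2}) = b" by (simp add: card_image)
    then show ?thesis unfolding tower_def by (auto simp: e_less iso tau2_simps)
  qed
  ultimately show "S \<in> towers b (\<lambda>i j. i < j \<and> \<pi> i < \<pi> j) {1..n}"
    using S(1) by (auto simp: towers_def)
qed

lemma num_occurrences_le:
  assumes "b \<ge> 3"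
  shows "\<exists>x\<le>n. num_occurrences (b + 2) (tau2 b) n \<pi> \<le> (x choose 2) * ((n - x) choose b)"
proof -
  let ?r = "\<lambda>i j. i < j \<and> \<pi> i < \<pi> j"
  obtain k where k: "b = Suc k" "k \<ge> 2" using assms by (cases b) auto
  have "irreflp ?r" "transp ?r" by (auto simp: irreflp_def transp_def)
  then obtain r where r: "weak_order_on {1..n} r"
    and le: "card (towers b ?r {1..n}) \<le> card (towers b r {1..n})"
    using ex_weak_order_towers_ge[of "{1..n}" ?r b] by auto
  \<comment> \<open>Weight \<open>0\<close>: there are no layers above the whole set.\<close>
  obtain x y where xy: "x + y = n"
    and bound: "card (tower_triples b r {1..n}) \<le> (x choose 2) * (y choose b)"
    using weak_order_towers_bound[OF k(2) _ r, of 0] k(1) by auto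
  have "num_occurrences (b + 2) (tau2 b) n \<pi> \<le> card (towers b ?r {1..n})"
    unfolding num_occurrences_def
    by (intro card_mono finite_towers occurrences_subset_towers) auto
  also note le
  also have "card (towers b r {1..n}) \<le> card (tower_triples b r {1..n})"
    by (rule card_towers_le_triples) simp
  also note bound
  finally show ?thesis using xy by (intro exI[of _ x]) auto
qed

text \<open>The pair from the antilayer plays the entries 1, 2 of the pattern, and the positions
  from the layer play its decreasing tail.\<close>

lemma Un_in_occurrences_antilayer_layer:
  assumes x: "x \<le> n" and A: "A \<subseteq> {1..x}" "card A = 2" and K: "K \<subseteq> {x + 1..n}" "card K = b"
  shows "A \<union> K \<in> occurrences (b + 2) (tau2 b) n (antilayer_layer n x)"
proof -
  obtain p q where pq: "A = {p, q}" "p < q"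
  proof -
    obtain u v where "A = {u, v}" "u \<noteq> v" using A(2) unfolding card_2_iff by blast
    moreover from this have "u < v \<or> v < u" by linarith
    ultimately show thesis using that[of u v] that[of v u] by (auto simp: insert_commute)
  qed
  have "finite K" using finite_subset[OF K(1)] by simp
  then obtain h where "bij_betw h {..<card K} K" "strict_mono_on {..<card K} h"
    by (rule ex_bij_betw_strict_mono_card)
  note h = this[unfolded K(2)]
  \<comment> \<open>The enumeration \<open>h\<close> of \<open>K\<close> starts at \<open>0\<close>,
    whereas the tail of the pattern starts at position 3.\<close>
  define e where "e i = (if i = 1 then p else if i = 2 then q else h (i - 3))" for i
  have low: "e (Suc 0) = p" "e 2 = q" "1 \<le> p" "q \<le> x" using A(1) pq by (auto simp: e_def)
  have high: "e i \<in> K" "x < e i" "e i \<le> n" if "i \<in> {3..b + 2}" for i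
  proof -
    have "i - 3 \<in> {..<b}" using that by auto
    then show "e i \<in> K" using that bij_betwE[OF h(1)] by (auto simp: e_def)
    then show "x < e i" "e i \<le> n" using K(1) by auto
  qed
  have high_less: "e i < e j" if "i \<in> {3..b + 2}" "j \<in> {3..b + 2}" "i < j" for i j
    using that strict_mono_onD[OF h(2), of "i - 3" "j - 3"] by (auto simp: e_def)
  have cases: "i = 1 \<or> i = 2 \<or> i \<in> {3..b + 2}" if "i \<in> {1..b + 2}" for i
    using that by auto
  have mono: "strict_mono_on {1..b + 2} e"
  proof (rule strict_mono_onI)
    fix i j assume ij: "i \<in> {1..b + 2}" "j \<in> {1..b + 2}" "i < j"
    show "e i < e j"
      using cases[OF ij(1)] cases[OF ij(2)] ij(3) low pq(2) high(2)[of j] high_less[of i j] by auto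
  qed
  have "K \<subseteq> e ` {3..b + 2}"
  proof
    fix y assume "y \<in> K"
    then obtain i where "i < b" "y = h i" using bij_betw_imp_surj_on[OF h(1)] by blast
    then show "y \<in> e ` {3..b + 2}" by (intro image_eqI[of _ _ "i + 3"]) (auto simp: e_def)
  qed
  then have "e ` {3..b + 2} = K" using high(1) by auto
  moreover have "{1..b + 2} = insert 1 (insert 2 {3..b + 2})" by auto
  ultimately have img: "e ` {1..b + 2} = A \<union> K" using low(1,2) pq(1) by simp
  have "card (A \<union> K) = b + 2"
    using card_image[OF strict_mono_on_imp_inj_on[OF mono]] img by simp
  moreover have "antilayer_layer n x (e i) < antilayer_layer n x (e j) \<longleftrightarrow> tau2 b i < tau2 b j"
    if ij: "i \<in> {1..b + 2}" "j \<in> {1..b + 2}" for i j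
  proof -
    have A_val: "antilayer_layer n x p = p" "antilayer_layer n x q = q"
      using x low pq by (auto simp: antilayer_layer_simps)
    have K_val: "antilayer_layer n x (e i) = n + x + 1 - e i" if "i \<in> {3..b + 2}" for i
      using x high[OF that] by (auto simp: antilayer_layer_simps)
    have less_iff: "e i < e j \<longleftrightarrow> i < j" using strict_mono_on_less[OF mono ij] .
    have less_iff': "e j < e i \<longleftrightarrow> j < i" using strict_mono_on_less[OF mono ij(2,1)] .
    show ?thesis
      using cases[OF ij(1)] cases[OF ij(2)]
    proof (elim disjE)
      \<comment> \<open>Both value formulas reverse the order of positions; the bounds
        \<open>e i \<le> n\<close> and \<open>e j \<le> n\<close> keep the truncated subtraction
        exact.\<close>
      assume i: "i \<in> {3..b + 2}" and j: "j \<in> {3..b + 2}"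
      then show ?thesis
        using less_iff less_iff' high(3)[OF i] high(3)[OF j] by (auto simp: K_val tau2_simps)
    qed (use low pq(2) high[of i] high[of j] in \<open>auto simp: A_val K_val tau2_simps\<close>)
  qed
  moreover have "A \<union> K \<subseteq> {1..n}" using A(1) K(1) x by fastforce
  ultimately show ?thesis using mono img unfolding occurrences_def by blast
qed

text \<open>Intersecting \<open>A \<union> K\<close> with the two blocks recovers \<open>A\<close>
  and \<open>K\<close>, so distinct choices give distinct occurrences.\<close>

lemma num_occurrences_antilayer_layer_ge:
  assumes "x \<le> n"
  shows "(x choose 2) * ((n - x) choose b) \<le> num_occurrences (b + 2) (tau2 b) n (antilayer_layer n x)"
proof -
  let ?A = "{A. A \<subseteq> {1..x} \<and> card A = 2}" and ?K = "{K. K \<subseteq> {x + 1..n} \<and> card K = b}"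
  let ?O = "occurrences (b + 2) (tau2 b) n (antilayer_layer n x)"
  have "inj_on (\<lambda>(A, K). A \<union> K) (?A \<times> ?K)"
  proof (rule inj_on_inverseI)
    fix AK assume "AK \<in> ?A \<times> ?K"
    then show "(\<lambda>S. (S \<inter> {1..x}, S \<inter> {x + 1..n})) ((\<lambda>(A, K). A \<union> K) AK) = AK" by fastforce
  qed
  then have "card (?A \<times> ?K) = card ((\<lambda>(A, K). A \<union> K) ` (?A \<times> ?K))"
    by (simp add: card_image)
  also have "\<dots> \<le> card ?O"
  proof (rule card_mono)
    show "finite ?O" by (rule finite_subset[of _ "Pow {1..n}"]) (auto simp: occurrences_def)
    show "(\<lambda>(A, K). A \<union> K) ` (?A \<times> ?K) \<subseteq> ?O"
      using Un_in_occurrences_antilayer_layer[OF assms] by auto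
  qed
  finally show ?thesis by (simp add: card_cartesian_product n_subsets num_occurrences_def)
qed

theorem corollary3p9:
  fixes \<beta> n :: nat
  assumes "\<beta> \<ge> 3" and "n \<ge> 1"
  shows "(\<exists>\<sigma>. \<sigma> permutes {1..n} \<and>
            (\<forall>\<pi>. \<pi> permutes {1..n} \<longrightarrow>
               num_occurrences (\<beta> + 2) (tau2 \<beta>) n \<pi> \<le> num_occurrences (\<beta> + 2) (tau2 \<beta>) n \<sigma>) \<and>
            (\<exists>x\<in>{0..n}. \<sigma> = antilayer_layer n x)) \<and>
         max_occurrences (\<beta> + 2) (tau2 \<beta>) n =
           Max ((\<lambda>x. (x choose 2) * ((n - x) choose \<beta>)) ` {0..n})"
proof -
  let ?N = "num_occurrences (\<beta> + 2) (tau2 \<beta>) n"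
  let ?f = "\<lambda>x. (x choose 2) * ((n - x) choose \<beta>)"
  have "Max (?f ` {0..n}) \<in> ?f ` {0..n}" by (rule Max_in) auto
  then obtain x where x: "x \<in> {0..n}" "Max (?f ` {0..n}) = ?f x"
    unfolding image_iff by blast
  have upper: "?N \<pi> \<le> ?f x" for \<pi>
  proof -
    obtain y where "y \<le> n" "?N \<pi> \<le> ?f y" using num_occurrences_le[OF assms(1)] by blast
    moreover from this have "?f y \<le> ?f x" unfolding x(2)[symmetric] by (intro Max_ge) auto
    ultimately show ?thesis by linarith
  qed
  have perm: "antilayer_layer n x permutes {1..n}"
    using antilayer_layer_permutes x(1) by simp
  \<comment> \<open>Equality follows from the explicit lower bound and from \<open>upper\<close>
    applied to this same permutation.\<close>
  have attained: "?N (antilayer_layer n x) = ?f x"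
    using num_occurrences_antilayer_layer_ge[of x n \<beta>] upper x(1) by (intro antisym) auto
  have "max_occurrences (\<beta> + 2) (tau2 \<beta>) n = ?f x"
    unfolding max_occurrences_def
  proof (rule Max_eqI)
    show "?f x \<in> ?N ` {\<sigma>. \<sigma> permutes {1..n}}" using perm attained by force
  qed (use upper in \<open>auto simp: finite_permutations\<close>)
  then show ?thesis using x perm upper attained by (auto intro!: exI[of _ "antilayer_layer n x"])
qed

end
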